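(* Let $M\ge 2$ be an integer, $S=\{0,1,\dots,M\}$, and let $P\colon S\times S\to[0,1]$ satisfy $P(a,0)=1$ and $P(0,b)=0$ for all $a,b\in S\setminus\{0\}$, and $$P(x,a)\,P(x+a,b)\le P(x,a+b)$$ for every $x\in\{0,\dots,M\}$, $a\in\{0,\dots,M-x\}$ and $b\in\{0,\dots,M-a\}$. Consider the two-person red-and-black game with total fortune $M$ and win probability function $P$. If player I plays the bold strategy, then the timid strategy is best for player II.
   Context: The two-person red-and-black game with total fortune $M$ (an integer $M\ge2$) and win probability function $P\colon S\times S\to[0,1]$, $S=\{0,\dots,M\}$, is as follows. Player I has initial fortune $x_0\in\mathbb N$ and player II has initial fortune $y_0\in\mathbb N$ (positive integers) with $x_0+y_0=M$. $X_n$ and $Y_n$ denote the fortunes of players I and II at stage $n\in\mathbb N$; $X_1=x_0$, $Y_1=y_0$. At stage $n$ the players simultaneously bid integers $a_n\in\{0,\dots,X_n\}$ (player I) and $b_n\in\{0,\dots,Y_n\}$ (player II), each without knowledge of the other's current bid; a player whose fortune is positive is not allowed to bid $0$. Given the bids, $$X_{n+1}=X_n+b_n \text{ with probability } P(a_n,b_n),\qquad X_{n+1}=X_n-a_n \text{ with probability } 1-P(a_n,b_n),$$ and $Y_{n+1}=M-X_{n+1}$. Under the boundary conditions $P(a,0)=1$, $P(0,b)=0$ for $a,b\ne0$, the states $X_n=0$ and $X_n=M$ are absorbing, and the game effectively ends when one of them is reached. The goal of each player is to reach fortune $M$ (player I: $X_m=M$ for some $m$; player II: $Y_m=M$, i.e.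 $X_m=0$, for some $m$). The value $P(0,0)$ is never used in the game and is an arbitrary number in $[0,1]$. A strategy of a player is a rule which at each stage $n$ prescribes an admissible bid as a function of the partial history $(X_1,\dots,X_n)$. The timid strategy: bid exactly one unit at each stage (while the own fortune is positive). The bold strategy: bid the entire current fortune at each stage. A strategy of a player is best (optimal) against a given strategy of the opponent if it maximizes, among all strategies of the player, the probability that the player reaches the goal $M$. *)

theory Defs
  imports "HOL-Probability.Probability"
begin

text \<open>
  A partial history is the nonempty list \<open>[X\<^sub>1, \<dots>, X\<^sub>n]\<close> of the fortunes of player I so far
  (most recent last); those of player II are \<open>Y\<^sub>i = M - X\<^sub>i\<close>. Throughout, \<open>M\<close> is the total fortune
  and \<open>P\<close> the win probability function, of which only the values on \<open>{0..M} \<times> {0..M}\<close> matter.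
\<close>

definition histories :: "nat \<Rightarrow> nat list set" where
  "histories M = {h. h \<noteq> [] \<and> set h \<subseteq> {0..M}}"

definition fortune1 :: "nat list \<Rightarrow> nat" where
  "fortune1 h = last h"

definition fortune2 :: "nat \<Rightarrow> nat list \<Rightarrow> nat" where
  "fortune2 M h = M - last h"

definition admissible :: "nat \<Rightarrow> nat \<Rightarrow> bool" where
  "admissible f a \<longleftrightarrow> a \<le> f \<and> (0 < f \<longrightarrow> 0 < a)"

text \<open>
  In the following three definitions \<open>f\<close> gives the own fortune of the player in question; it is
  \<^const>\<open>fortune1\<close> for player I and \<open>fortune2 M\<close> for player II.
\<close>

definition strategy :: "nat \<Rightarrow> (nat list \<Rightarrow> nat) \<Rightarrow> (nat list \<Rightarrow> nat) \<Rightarrow> bool" where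
  "strategy M f s \<longleftrightarrow> (\<forall>h\<in>histories M. admissible (f h) (s h))"

definition timid :: "(nat list \<Rightarrow> nat) \<Rightarrow> nat list \<Rightarrow> nat" where
  "timid f h = (if 0 < f h then 1 else 0)"

definition bold :: "(nat list \<Rightarrow> nat) \<Rightarrow> nat list \<Rightarrow> nat" where
  "bold f h = f h"

text \<open>
  The law of the next fortune of player I, given his current fortune \<open>x\<close> and the bids \<open>a\<close>, \<open>b\<close>.
\<close>

definition stage :: "(nat \<Rightarrow> nat \<Rightarrow> real) \<Rightarrow> nat \<Rightarrow> nat \<Rightarrow> nat \<Rightarrow> nat pmf" where
  "stage P x a b = map_pmf (\<lambda>win. if win then x + b else x - a) (bernoulli_pmf (P a b))"

text \<open>
  The fortunes of player I form a random element of \<open>nat \<Rightarrow> nat\<close>. The coordinate \<open>n\<close> of such a path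
  \<open>\<omega>\<close> is the fortune \<open>X\<close> at stage \<open>n + 1\<close>, so that \<open>stage_kernel\<close> at \<open>n\<close> is the conditional law of
  \<open>\<omega> n\<close> given \<open>\<omega> 0, \<dots>, \<omega> (n - 1)\<close>, and its value at \<open>0\<close> is the initial law.
\<close>

definition stage_kernel ::
  "(nat \<Rightarrow> nat \<Rightarrow> real) \<Rightarrow> nat \<Rightarrow> (nat list \<Rightarrow> nat) \<Rightarrow> (nat list \<Rightarrow> nat) \<Rightarrow>
     nat \<Rightarrow> (nat \<Rightarrow> nat) \<Rightarrow> nat measure"
  where
  "stage_kernel P x0 s1 s2 n \<omega> = measure_pmf
     (if n = 0 then return_pmf x0
      else let h = map \<omega> [0..<n] in stage P (fortune1 h) (s1 h) (s2 h))"

lemma Ionescu_Tulcea_kernel: "Ionescu_Tulcea (stage_kernel P x0 s1 s2) (\<lambda>_. count_space UNIV)"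
proof (rule Ionescu_Tulcea.intro)
  fix i :: nat
  have sub: "stage_kernel P x0 s1 s2 i \<omega> \<in> space (subprob_algebra (count_space UNIV))" for \<omega>
    unfolding stage_kernel_def by (rule measure_pmf_in_subprob_algebra)
  have PiM: "PiM {0..<i} (\<lambda>_. count_space UNIV) =
      count_space (PiE {0..<i} (\<lambda>_. UNIV :: nat set))"
    by (rule count_space_PiM_finite) simp_all
  show "stage_kernel P x0 s1 s2 i \<in> measurable (PiM {0..<i} (\<lambda>_. count_space UNIV))
      (subprob_algebra (count_space UNIV))"
    unfolding PiM by (simp add: sub)
next
  fix i \<omega>
  show "prob_space (stage_kernel P x0 s1 s2 i \<omega>)"
    unfolding stage_kernel_def by (rule prob_space_measure_pmf)
qed

definition game_measure ::
  "(nat \<Rightarrow> nat \<Rightarrow> real) \<Rightarrow> nat \<Rightarrow> (nat list \<Rightarrow> nat) \<Rightarrow> (nat list \<Rightarrow> nat) \<Rightarrow> (nat \<Rightarrow> nat) measure" where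
  "game_measure P x0 s1 s2 =
     projective_family.lim UNIV
       (Ionescu_Tulcea.CI (stage_kernel P x0 s1 s2) (\<lambda>_. count_space UNIV)) (\<lambda>_. count_space UNIV)"

text \<open>Player II reaches the goal when \<open>Y = M - X\<close> equals \<open>M\<close> at some stage.\<close>

definition goal2_prob ::
  "nat \<Rightarrow> (nat \<Rightarrow> nat \<Rightarrow> real) \<Rightarrow> nat \<Rightarrow> (nat list \<Rightarrow> nat) \<Rightarrow> (nat list \<Rightarrow> nat) \<Rightarrow> real" where
  "goal2_prob M P x0 s1 s2 =
     measure (game_measure P x0 s1 s2) {\<omega> \<in> space (game_measure P x0 s1 s2). \<exists>n. M - \<omega> n = M}"

definition best2 ::
  "nat \<Rightarrow> (nat \<Rightarrow> nat \<Rightarrow> real) \<Rightarrow> nat \<Rightarrow> (nat list \<Rightarrow> nat) \<Rightarrow> (nat list \<Rightarrow> nat) \<Rightarrow> bool" where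
  "best2 M P x0 s1 s2 \<longleftrightarrow> strategy M (fortune2 M) s2 \<and>
     (\<forall>s. strategy M (fortune2 M) s \<longrightarrow> goal2_prob M P x0 s1 s \<le> goal2_prob M P x0 s1 s2)"

lemma strategy_bold: "strategy M f (bold f)"
  by (auto simp: strategy_def bold_def admissible_def)

lemma strategy_timid: "strategy M f (timid f)"
  by (auto simp: strategy_def timid_def admissible_def)

context
begin

interpretation game: Ionescu_Tulcea "stage_kernel P x0 s1 s2" "\<lambda>_. count_space UNIV" for P x0 s1 s2
  by (rule Ionescu_Tulcea_kernel)

lemma game_measure_eq: "game_measure P x0 s1 s2 = game.PF.lim P x0 s1 s2"
  by (rule game_measure_def)

lemma space_game_measure: "space (game_measure P x0 s1 s2) = UNIV"
  by (simp add: game_measure_eq space_PiM)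

lemma emeasure_game_measure:
  "emeasure (game_measure P x0 s1 s2) {\<omega>. \<forall>i<n. \<omega> i = v i} =
   emeasure (game.C P x0 s1 s2 0 n (\<lambda>_. undefined)) {restrict v {0..<n}}"
proof -
  let ?M = "\<lambda>_::nat. count_space (UNIV :: nat set)"
  let ?X = "{restrict v {0..<n}}"
  have X: "?X \<in> sets (PiM {0..<n} ?M)"
    by (subst count_space_PiM_finite) auto
  have "game.PF.emb UNIV {0..<n} ?X = {\<omega>. \<forall>i<n. \<omega> i = v i}"
    by (auto simp: prod_emb_def fun_eq_iff restrict_def split: if_splits)
  moreover have "game.PF.emb {0..<n} {0..<n} ?X = ?X"
    by (auto simp: prod_emb_def extensional_def fun_eq_iff)
  ultimately show ?thesis
    using game.lim[OF _ X, of P x0 s1 s2] game.emeasure_CI[OF _ X, of n P x0 s1 s2]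
    by (simp add: game_measure_eq)
qed

lemma prob_space_game_measure: "prob_space (game_measure P x0 s1 s2)"
proof
  have "emeasure (game_measure P x0 s1 s2) UNIV =
      emeasure (game.C P x0 s1 s2 0 0 (\<lambda>_. undefined)) {restrict undefined {0..<0}}"
    using emeasure_game_measure[of P x0 s1 s2 0] by simp
  then show "emeasure (game_measure P x0 s1 s2) (space (game_measure P x0 s1 s2)) = 1"
    by (simp add: space_game_measure PiM_empty restrict_def)
qed

lemma goal2_event_measurable:
  "{\<omega> \<in> space (game_measure P x0 s1 s2). \<exists>n. M - \<omega> n = M} \<in> sets (game_measure P x0 s1 s2)"
proof -
  have "(\<lambda>\<omega>. \<omega> n) -` {k. M - k = M} \<inter> space (game_measure P x0 s1 s2) \<in> sets (game_measure P x0 s1 s2)" for n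
    by (rule measurable_sets[of _ _ "count_space UNIV"])
       (simp_all add: game_measure_eq measurable_cong_sets[OF game.PF.sets_lim refl])
  then have "(\<Union>n. (\<lambda>\<omega>. \<omega> n) -` {k. M - k = M} \<inter> space (game_measure P x0 s1 s2))
      \<in> sets (game_measure P x0 s1 s2)"
    by blast
  moreover have "(\<Union>n. (\<lambda>\<omega>. \<omega> n) -` {k. M - k = M} \<inter> space (game_measure P x0 s1 s2)) =
      {\<omega> \<in> space (game_measure P x0 s1 s2). \<exists>n. M - \<omega> n = M}"
    by auto
  ultimately show ?thesis by simp
qed

text \<open>The joint law of \<open>X\<^sub>1, \<dots>, X\<^sub>n\<close>, one stage at a time.\<close>

lemma game_measure_Suc:
  "measure (game_measure P x0 s1 s2) {\<omega>. \<forall>i<Suc n. \<omega> i = v i} =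
   measure (game_measure P x0 s1 s2) {\<omega>. \<forall>i<n. \<omega> i = v i} * measure (stage_kernel P x0 s1 s2 n v) {v n}"
proof -
  let ?M = "\<lambda>_::nat. count_space (UNIV :: nat set)" and ?K = "stage_kernel P x0 s1 s2"
  let ?C = "game.C P x0 s1 s2 0 n (\<lambda>_. undefined)"
  have und: "(\<lambda>_. undefined) \<in> space (PiM {0..<0} ?M)"
    by (simp add: space_PiM)
  have X: "{restrict v {0..<m}} \<in> sets (PiM {0..<m} ?M)" for m
    by (subst count_space_PiM_finite) auto
  have sets_C: "sets ?C = sets (PiM {0..<n} ?M)"
    using game.sets_C[OF und, of P x0 s1 s2 n] by simp
  have eP: "emeasure (game.eP P x0 s1 s2 n \<omega>) {restrict v {0..<Suc n}} =
      emeasure (?K n v) {v n} * indicator {restrict v {0..<n}} \<omega>"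
    if \<omega>: "\<omega> \<in> space (PiM {0..<n} ?M)" for \<omega>
  proof (cases "\<omega> = restrict v {0..<n}")
    case True
    have "map \<omega> [0..<n] = map v [0..<n]"
      by (simp add: True)
    then have "?K n \<omega> = ?K n v"
      by (simp only: stage_kernel_def)
    have x: "x = v n" if "fun_upd \<omega> n x = restrict v {0..<Suc n}" for x
      using fun_cong[OF that, of n] by simp
    have "(\<lambda>x. fun_upd \<omega> n x) -` {restrict v {0..<Suc n}} = {v n}"
    proof (intro set_eqI iffI)
      fix x assume "x \<in> {v n}"
      then show "x \<in> (\<lambda>x. fun_upd \<omega> n x) -` {restrict v {0..<Suc n}}"
        by (auto simp: True fun_eq_iff restrict_def)
    qed (use x in \<open>simp del: fun_upd_apply\<close>)
    then have "emeasure (game.eP P x0 s1 s2 n \<omega>) {restrict v {0..<Suc n}} = emeasure (?K n v) {v n}"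
      unfolding game.emeasure_eP[OF \<omega> X] \<open>?K n \<omega> = ?K n v\<close> by simp
    then show ?thesis
      using True by simp
  next
    case False
    have "(\<lambda>x. fun_upd \<omega> n x) -` {restrict v {0..<Suc n}} = {}"
    proof -
      have "\<omega> = restrict v {0..<n}" if "fun_upd \<omega> n x = restrict v {0..<Suc n}" for x
      proof
        fix i
        show "\<omega> i = restrict v {0..<n} i"
          using fun_cong[OF that, of i] \<omega>
          by (cases "i < n") (auto simp: space_PiM PiE_iff extensional_def split: if_splits)
      qed
      with False show ?thesis by auto
    qed
    then show ?thesis
      using False by (simp add: game.emeasure_eP[OF \<omega> X])
  qed
  have "emeasure (game.C P x0 s1 s2 0 (Suc n) (\<lambda>_. undefined)) {restrict v {0..<Suc n}} =
      (\<integral>\<^sup>+\<omega>. emeasure (game.eP P x0 s1 s2 n \<omega>) {restrict v {0..<Suc n}} \<partial>?C)"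
  proof -
    have "game.eP P x0 s1 s2 n \<in> measurable ?C (subprob_algebra (PiM {0..<Suc n} ?M))"
      using game.measurable_eP[of P x0 s1 s2 n] by (simp add: measurable_cong_sets[OF sets_C])
    moreover have "space ?C \<noteq> {}"
      by (rule prob_space.not_empty[OF game.prob_space_C[OF und]])
    ultimately show ?thesis
      by (simp del: fun_upd_apply add: emeasure_bind[OF _ _ X])
  qed
  also have "\<dots> = (\<integral>\<^sup>+\<omega>. emeasure (?K n v) {v n} * indicator {restrict v {0..<n}} \<omega> \<partial>?C)"
    using game.space_C[OF und, of P x0 s1 s2 n] by (intro nn_integral_cong eP) simp
  also have "\<dots> = emeasure (?K n v) {v n} * emeasure ?C {restrict v {0..<n}}"
    using X by (intro nn_integral_cmult_indicator) (simp add: sets_C)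
  finally show ?thesis
    by (simp add: emeasure_game_measure measure_def enn2real_mult mult.commute del: game.C.simps)
qed

end

end

theory Submission
  imports Defs
begin

text \<open>
  Against the bold strategy of player I, player II wins as soon as he wins a single stage. So the only
  way for player I to survive is a deterministic path of fortunes \<open>x\<^sub>0 = v\<^sub>0 < v\<^sub>1 < \<dots> < M\<close>, which has
  probability \<open>\<Prod>\<^sub>i P (v\<^sub>i) (v\<^sub>i\<^sub>+\<^sub>1 - v\<^sub>i)\<close>. Iterating the hypothesis on \<open>P\<close> bounds each factor from below
  by the product of \<open>P k 1\<close> over \<open>v\<^sub>i \<le> k < v\<^sub>i\<^sub>+\<^sub>1\<close>, that is, by what unit bids give.
\<close>

section \<open>Measurability of events on paths of fortunes\<close>

lemma sets_game_measure:
  "sets (game_measure P x0 s1 s2) = sets (PiM UNIV (\<lambda>_. count_space UNIV))"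
proof -
  interpret game: Ionescu_Tulcea "stage_kernel P x0 s1 s2" "\<lambda>_. count_space UNIV"
    by (rule Ionescu_Tulcea_kernel)
  show ?thesis
    unfolding game_measure_def by (rule game.PF.sets_lim)
qed

lemma coordinate_event_measurable:
  "{\<omega>. Q (\<omega> n)} \<in> sets (game_measure P x0 s1 s2)"
proof -
  have "(\<lambda>\<omega>. \<omega> n) \<in> measurable (game_measure P x0 s1 s2) (count_space UNIV)"
    unfolding measurable_cong_sets[OF sets_game_measure refl]
    by (rule measurable_component_singleton) simp
  then have "(\<lambda>\<omega>. \<omega> n) -` {k. Q k} \<inter> space (game_measure P x0 s1 s2) \<in> sets (game_measure P x0 s1 s2)"
    by (rule measurable_sets) simp
  then show ?thesis
    by (simp add: space_game_measure vimage_def)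
qed

lemma cylinder_measurable:
  "{\<omega>. \<forall>i<n. \<omega> i = v i} \<in> sets (game_measure P x0 s1 s2)"
proof (induction n)
  case 0
  then show ?case
    using sets.top[of "game_measure P x0 s1 s2"] by (simp add: space_game_measure)
next
  case (Suc n)
  have "{\<omega>. \<forall>i<Suc n. \<omega> i = v i} = {\<omega>. \<forall>i<n. \<omega> i = v i} \<inter> {\<omega>. \<omega> n = v n}"
    by (auto simp: less_Suc_eq)
  moreover have "{\<omega>. \<omega> n = v n} \<in> sets (game_measure P x0 s1 s2)"
    by (rule coordinate_event_measurable)
  ultimately show ?case
    using Suc by (simp only: sets.Int)
qed

section \<open>The all-win path of player I and its probability\<close>

locale bold_game =
  fixes M x0 :: nat and P :: "nat \<Rightarrow> nat \<Rightarrow> real" and s :: "nat list \<Rightarrow> nat"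
  assumes P_bounds: "\<And>a b. a \<in> {0..M} \<Longrightarrow> b \<in> {0..M} \<Longrightarrow> 0 \<le> P a b \<and> P a b \<le> 1"
    and P_0: "\<And>a. a \<in> {0..M} \<Longrightarrow> a \<noteq> 0 \<Longrightarrow> P a 0 = 1"
    and P_split: "\<And>x a b. x \<in> {0..M} \<Longrightarrow> a \<in> {0..M - x} \<Longrightarrow> b \<in> {0..M - a} \<Longrightarrow>
           P x a * P (x + a) b \<le> P x (a + b)"
    and x0: "0 < x0" "x0 < M"
    and strat: "strategy M (fortune2 M) s"
begin

abbreviation G :: "(nat \<Rightarrow> nat) measure" where
  "G \<equiv> game_measure P x0 (bold fortune1) s"

sublocale G: prob_space G
  by (rule prob_space_game_measure)

text \<open>The partial histories along which player I has won every stage.\<close>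

primrec hist :: "nat \<Rightarrow> nat list" where
  "hist 0 = [x0]"
| "hist (Suc n) = hist n @ [last (hist n) + s (hist n)]"

text \<open>An infinite path even if \<open>M\<close> is reached: there player II has fortune 0 and
  must bid 0, so \<open>v\<close> stays at \<open>M\<close>.\<close>

definition v :: "nat \<Rightarrow> nat" where
  "v n = last (hist n)"

lemma v_0: "v 0 = x0"
  by (simp add: v_def)

lemma v_Suc: "v (Suc n) = v n + s (hist n)"
  by (simp add: v_def)

lemma map_v: "map v [0..<Suc n] = hist n"
proof (induction n)
  case 0
  then show ?case by (simp add: v_0)
next
  case (Suc n)
  have "map v [0..<Suc (Suc n)] = map v [0..<Suc n] @ [v (Suc n)]"
    by simp
  also have "\<dots> = hist (Suc n)"
    unfolding Suc by (simp add: v_def)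
  finally show ?case .
qed

lemma hist_mem: "hist n \<in> histories M \<and> last (hist n) \<in> {x0..M}"
proof (induction n)
  case 0
  then show ?case using x0 by (simp add: histories_def)
next
  case (Suc n)
  then have "s (hist n) \<le> M - last (hist n)"
    using strat by (auto simp: strategy_def admissible_def fortune2_def)
  with Suc show ?case
    by (auto simp: histories_def)
qed

lemma v_bounds: "x0 \<le> v n" "v n \<le> M"
  using hist_mem[of n] by (simp_all add: v_def)

lemma bid_le: "v n + s (hist n) \<le> M"
  using v_bounds(2)[of "Suc n"] by (simp add: v_Suc)

text \<open>A lost bold bid costs the whole fortune, hence the outcome 0. Agreement with
  \<open>v\<close> is assumed only below \<open>Suc n\<close>, since the kernel sees only the past;
  paths leaving \<open>v\<close> at \<open>Suc n\<close> are thus covered too.\<close>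

lemma stage_kernel_v:
  assumes "\<And>i. i < Suc n \<Longrightarrow> w i = v i"
  shows "stage_kernel P x0 (bold fortune1) s (Suc n) w =
    measure_pmf (map_pmf (\<lambda>win. if win then v (Suc n) else 0) (bernoulli_pmf (P (v n) (s (hist n)))))"
proof -
  have "map w [0..<Suc n] = hist n"
    unfolding map_v[symmetric] using assms by (intro map_cong) auto
  then show ?thesis
    by (simp add: stage_kernel_def stage_def bold_def fortune1_def v_def Let_def
      cong: if_cong del: upt_Suc)
qed

lemma measure_stage_kernel_v:
  "measure (stage_kernel P x0 (bold fortune1) s (Suc n) v) {v (Suc n)} = P (v n) (s (hist n))"
proof -
  \<comment> \<open>Win and loss lead to different fortunes because \<open>v (Suc n)\<close> is at
    least \<open>x0 > 0\<close>.\<close>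
  have "(\<lambda>win. if win then v (Suc n) else 0) -` {v (Suc n)} = {True}"
    using v_bounds(1)[of "Suc n"] x0 by (auto split: if_splits)
  moreover have "0 \<le> P (v n) (s (hist n)) \<and> P (v n) (s (hist n)) \<le> 1"
    using P_bounds[of "v n" "s (hist n)"] bid_le[of n] by simp
  ultimately show ?thesis
    by (simp only: stage_kernel_v measure_map_pmf) (simp add: measure_pmf_single)
qed

text \<open>After a past along \<open>v\<close>, the kernel is supported in
  \<open>{v n, 0}\<close>.\<close>

lemma measure_stage_kernel_off:
  assumes "\<And>i. i < n \<Longrightarrow> w i = v i" "w n \<noteq> v n" "w n \<noteq> 0"
  shows "measure (stage_kernel P x0 (bold fortune1) s n w) {w n} = 0"
proof (cases n)
  case 0
  then show ?thesis
    using assms v_0 by (simp add: stage_kernel_def measure_return)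
next
  case (Suc m)
  have "(\<lambda>win. if win then v (Suc m) else 0) -` {w n} = {}"
    using assms Suc by (auto split: if_splits)
  then show ?thesis
    using stage_kernel_v[of m w] assms(1) by (simp add: Suc measure_map_pmf)
qed

text \<open>There are \<open>Suc n\<close> coordinates but only \<open>n\<close> factors, as the
  initial law is the point mass at \<open>x0 = v 0\<close>.\<close>

lemma measure_cylinder:
  "measure G {\<omega>. \<forall>i<Suc n. \<omega> i = v i} = (\<Prod>i<n. P (v i) (s (hist i)))"
proof (induction n)
  case 0
  have "measure (stage_kernel P x0 (bold fortune1) s 0 v) {v 0} = 1"
    by (simp add: stage_kernel_def v_0 measure_return)
  moreover have "measure G {\<omega>. \<forall>i<0. \<omega> i = v i} = 1"
    using G.prob_space by (simp add: space_game_measure)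
  ultimately show ?case
    using game_measure_Suc[of P x0 "bold fortune1" s 0 v] by simp
next
  case (Suc n)
  then show ?case
    by (subst game_measure_Suc) (simp add: measure_stage_kernel_v)
qed

lemma null_sets_off:
  assumes "c \<noteq> v n" "c \<noteq> 0"
  shows "{\<omega>. (\<forall>i<n. \<omega> i = v i) \<and> \<omega> n = c} \<in> null_sets G"
proof -
  \<comment> \<open>This turns the event into a cylinder, to which \<open>game_measure_Suc\<close>
    applies with a vanishing last factor.\<close>
  let ?w = "v(n := c)"
  have eq: "{\<omega>. (\<forall>i<n. \<omega> i = v i) \<and> \<omega> n = c} = {\<omega>. \<forall>i<Suc n. \<omega> i = ?w i}"
    by (auto simp: less_Suc_eq)
  have "measure G {\<omega>. \<forall>i<Suc n. \<omega> i = ?w i} = 0"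
    using measure_stage_kernel_off[of n ?w] assms by (subst game_measure_Suc) simp
  then show ?thesis
    unfolding eq by (intro null_setsI cylinder_measurable) (simp add: G.emeasure_eq_measure)
qed

section \<open>The survival probability of player I\<close>

lemma survival_measurable: "{\<omega>. \<forall>n. \<omega> n \<noteq> 0} \<in> sets G"
proof -
  have "(\<Inter>n. {\<omega>. \<omega> n \<noteq> 0}) \<in> sets G"
    by (intro sets.countable_INT' coordinate_event_measurable image_subsetI)
       (auto intro: coordinate_event_measurable)
  then show ?thesis
    by (simp add: Collect_all_eq[symmetric])
qed

lemma goal2_prob_eq:
  "goal2_prob M P x0 (bold fortune1) s = 1 - measure G {\<omega>. \<forall>n. \<omega> n \<noteq> 0}"
proof -
  have "{\<omega> \<in> space G. \<exists>n. M - \<omega> n = M} = space G - {\<omega>. \<forall>n. \<omega> n \<noteq> 0}"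
  proof -
    \<comment> \<open>With truncated subtraction this rests on \<open>M > 0\<close>.\<close>
    have "M - k = M \<longleftrightarrow> k = 0" for k
      using x0 by (cases "k \<le> M") auto
    then show ?thesis
      by (simp only: space_game_measure) blast
  qed
  then show ?thesis
    unfolding goal2_prob_def using G.prob_compl[OF survival_measurable] by simp
qed

text \<open>Almost every surviving path is \<open>v\<close> itself, hence lies in each cylinder
  around \<open>v\<close>.\<close>

lemma survival_le:
  "measure G {\<omega>. \<forall>n. \<omega> n \<noteq> 0} \<le> (\<Prod>i<n. P (v i) (s (hist i)))"
proof -
  \<comment> \<open>The paths whose first deviation from \<open>v\<close> is to a nonzero value. A
    surviving path other than \<open>v\<close> has such a deviation.\<close>
  let ?N = "\<Union>m. \<Union>c\<in>- {v m, 0}. {\<omega>. (\<forall>i<m. \<omega> i = v i) \<and> \<omega> m = c}"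
  let ?C = "{\<omega>. \<forall>i<Suc n. \<omega> i = v i}"
  have N: "?N \<in> null_sets G"
    by (intro null_sets_UN null_sets_UN' countableI_type null_sets_off) auto
  have "{\<omega>. \<forall>n. \<omega> n \<noteq> 0} \<subseteq> ?C \<union> ?N"
  proof (intro subsetI UnCI)
    fix \<omega> :: "nat \<Rightarrow> nat"
    assume \<omega>: "\<omega> \<in> {\<omega>. \<forall>n. \<omega> n \<noteq> 0}" and "\<omega> \<notin> ?N"
    then have "\<omega> i = v i" for i
      by (induction i rule: less_induct) auto
    then show "\<omega> \<in> ?C"
      by simp
  qed
  then have "measure G {\<omega>. \<forall>n. \<omega> n \<noteq> 0} \<le> measure G (?C \<union> ?N)"
    using N by (intro G.finite_measure_mono sets.Un cylinder_measurable) auto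
  also have "\<dots> = measure G ?C"
    by (rule measure_Un_null_set[OF cylinder_measurable N])
  finally show ?thesis
    by (simp only: measure_cylinder)
qed

text \<open>The cylinders decrease to the single path \<open>v\<close>, which never visits 0, so
  continuity from above carries a bound uniform in \<open>n\<close> to the limit.\<close>

lemma survival_ge:
  assumes "\<And>n. q \<le> (\<Prod>i<n. P (v i) (s (hist i)))"
  shows "q \<le> measure G {\<omega>. \<forall>n. \<omega> n \<noteq> 0}"
proof -
  let ?C = "\<lambda>n. {\<omega>. \<forall>i<Suc n. \<omega> i = v i}"
  have "(\<lambda>n. measure G (?C n)) \<longlonglongrightarrow> measure G (\<Inter>n. ?C n)"
    by (intro G.finite_Lim_measure_decseq) (auto simp: cylinder_measurable decseq_def)
  then have "q \<le> measure G (\<Inter>n. ?C n)"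
    by (rule LIMSEQ_le_const) (use assms in \<open>simp only: measure_cylinder\<close>, blast)
  also have "\<dots> \<le> measure G {\<omega>. \<forall>n. \<omega> n \<noteq> 0}"
  proof (intro G.finite_measure_mono survival_measurable)
    have "\<omega> n \<noteq> 0" if "\<omega> \<in> (\<Inter>n. ?C n)" for \<omega> n
    proof -
      have "\<omega> n = v n"
        using that by blast
      then show ?thesis
        using v_bounds(1)[of n] x0 by simp
    qed
    then show "(\<Inter>n. ?C n) \<subseteq> {\<omega>. \<forall>n. \<omega> n \<noteq> 0}"
      by blast
  qed
  finally show ?thesis .
qed

section \<open>Comparison with unit bids\<close>

lemma P_1_bounds: "k < M \<Longrightarrow> 0 \<le> P k 1 \<and> P k 1 \<le> 1"
  by (rule P_bounds) auto

text \<open>\<open>P_split\<close> with \<open>a = 1\<close> splits off the first unit and moves the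
  start to \<open>x + 1\<close>, so \<open>x\<close> varies in the induction. For
  \<open>b = 0\<close>, \<open>0 < x\<close> gives \<open>P x 0 = 1\<close>.\<close>

lemma prod_unit_le_P:
  assumes "0 < x" "x + b \<le> M"
  shows "(\<Prod>k=x..<x + b. P k 1) \<le> P x b"
  using assms
proof (induction b arbitrary: x)
  case 0
  then show ?case by (simp add: P_0)
next
  case (Suc b)
  have "(\<Prod>k=x..<x + Suc b. P k 1) = P x 1 * (\<Prod>k=Suc x..<Suc x + b. P k 1)"
    by (simp add: prod.atLeast_Suc_lessThan)
  also have "\<dots> \<le> P x 1 * P (x + 1) b"
    using Suc.IH[of "Suc x"] Suc.prems P_1_bounds[of x] by (intro mult_left_mono) auto
  also have "\<dots> \<le> P x (1 + b)"
    using Suc.prems by (intro P_split) auto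
  finally show ?case by simp
qed

lemma prod_unit_nonneg: "y \<le> M \<Longrightarrow> 0 \<le> (\<Prod>k=x..<y. P k 1)"
  by (intro prod_nonneg ballI conjunct1[OF P_1_bounds]) auto

text \<open>The intervals from \<open>v i\<close> to \<open>v (Suc i)\<close> tile the one from
  \<open>x0\<close> to \<open>v n\<close>; each is handled by \<open>prod_unit_le_P\<close>.\<close>

lemma prod_unit_le_path:
  "(\<Prod>k=x0..<v n. P k 1) \<le> (\<Prod>i<n. P (v i) (s (hist i)))"
proof (induction n)
  case 0
  then show ?case by (simp add: v_0)
next
  case (Suc n)
  have "(\<Prod>k=x0..<v (Suc n). P k 1) =
      (\<Prod>k=x0..<v n. P k 1) * (\<Prod>k=v n..<v n + s (hist n). P k 1)"
    using v_bounds(1)[of n] by (simp add: prod.atLeastLessThan_concat v_Suc)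
  also have "\<dots> \<le> (\<Prod>i<n. P (v i) (s (hist i))) * P (v n) (s (hist n))"
  proof (rule mult_mono[OF Suc])
    show "(\<Prod>k=v n..<v n + s (hist n). P k 1) \<le> P (v n) (s (hist n))"
      using v_bounds(1)[of n] x0 bid_le by (intro prod_unit_le_P) auto
    show "0 \<le> (\<Prod>i<n. P (v i) (s (hist i)))"
      by (rule order_trans[OF prod_unit_nonneg Suc]) (rule v_bounds)
  qed (rule prod_unit_nonneg bid_le)+
  finally show ?case by simp
qed

text \<open>\<open>survival_ge\<close> asks for a bound free of \<open>n\<close>; extending the
  product from \<open>v n\<close> to \<open>M\<close> gives one, as the extra factors are at most
  1.\<close>

lemma goal2_prob_le:
  "goal2_prob M P x0 (bold fortune1) s \<le> 1 - (\<Prod>k=x0..<M. P k 1)"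
proof -
  have "(\<Prod>k=x0..<M. P k 1) \<le> (\<Prod>k=x0..<v n. P k 1)" for n
  proof -
    have "(\<Prod>k=x0..<M. P k 1) = (\<Prod>k=x0..<v n. P k 1) * (\<Prod>k=v n..<M. P k 1)"
      using v_bounds[of n] by (simp add: prod.atLeastLessThan_concat)
    also have "\<dots> \<le> (\<Prod>k=x0..<v n. P k 1) * 1"
      using v_bounds[of n] P_1_bounds by (intro mult_left_mono prod_le_1 prod_unit_nonneg) auto
    finally show ?thesis by simp
  qed
  then show ?thesis
    unfolding goal2_prob_eq
    by (intro diff_left_mono survival_ge) (rule order_trans[OF _ prod_unit_le_path])
qed

text \<open>To survive, player I must win the first \<open>M - x0\<close> stages, and against unit
  bids these cover exactly the fortunes from \<open>x0\<close> to \<open>M - 1\<close>.\<close>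

lemma goal2_prob_timid:
  assumes "s = timid (fortune2 M)"
  shows "1 - (\<Prod>k=x0..<M. P k 1) \<le> goal2_prob M P x0 (bold fortune1) s"
proof -
  have bid: "s (hist n) = (if v n < M then 1 else 0)" for n
    unfolding v_def by (simp add: assms timid_def fortune2_def)
  \<comment> \<open>The range ends where \<open>v\<close> reaches \<open>M\<close> and the timid bid
    drops to 0.\<close>
  have v_eq: "n \<le> M - x0 \<Longrightarrow> v n = x0 + n" for n
    by (induction n) (auto simp: v_0 v_Suc bid)
  have "(\<Prod>i<M - x0. P (v i) (s (hist i))) = (\<Prod>i<M - x0. P (x0 + i) 1)"
    by (intro prod.cong) (auto simp: bid v_eq)
  also have "\<dots> = (\<Prod>k=x0..<M. P k 1)"
    using prod.atLeastLessThan_shift_0[of "\<lambda>k. P k 1" x0 M] by (simp add: lessThan_atLeast0)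
  finally show ?thesis
    unfolding goal2_prob_eq using survival_le[of "M - x0"] by simp
qed

end

theorem theorem3:
  fixes M x0 y0 :: nat and P :: "nat \<Rightarrow> nat \<Rightarrow> real"
  assumes "2 \<le> M"
    and "\<And>a b. a \<in> {0..M} \<Longrightarrow> b \<in> {0..M} \<Longrightarrow> 0 \<le> P a b \<and> P a b \<le> 1"
    and "\<And>a. a \<in> {0..M} \<Longrightarrow> a \<noteq> 0 \<Longrightarrow> P a 0 = 1"
    and "\<And>b. b \<in> {0..M} \<Longrightarrow> b \<noteq> 0 \<Longrightarrow> P 0 b = 0"
    and "\<And>x a b. x \<in> {0..M} \<Longrightarrow> a \<in> {0..M - x} \<Longrightarrow> b \<in> {0..M - a} \<Longrightarrow>
           P x a * P (x + a) b \<le> P x (a + b)"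
    and "0 < x0" and "0 < y0" and "x0 + y0 = M"
  shows "best2 M P x0 (bold fortune1) (timid (fortune2 M))"
proof -
  have game: "bold_game M x0 P s" if "strategy M (fortune2 M) s" for s
  proof
    show "x0 < M" using assms by simp
  qed (fact assms that)+
  \<comment> \<open>The same number, independent of \<open>s\<close>, bounds every strategy from
    above and the timid one from below.\<close>
  show ?thesis
    unfolding best2_def
    using bold_game.goal2_prob_le[OF game] bold_game.goal2_prob_timid[OF game[OF strategy_timid] refl]
      strategy_timid
    by (meson order_trans)
qed

end
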